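(* As $n\to\infty$, $$G_3(n)\leq \pi(n)+\pi(n/2)+n^{2/3}(\log n)^{2^{1/3}-1/3+o(1)},$$ where $G_3(n)$ denotes the maximal size of a set $A\subseteq\{1,2,\dots,n\}$ such that the equation $s_1s_2s_3=t_1t_2t_3$ has no solution with $s_1,s_2,s_3,t_1,t_2,t_3$ six pairwise distinct elements of $A$.
   Context: A set $A\subseteq\mathbb{N}$ (positive integers) is called a multiplicative $3$-Sidon set if the equation $s_1s_2s_3=t_1t_2t_3$ has no solution in $A$ consisting of distinct elements (all six of $s_1,s_2,s_3,t_1,t_2,t_3$ pairwise distinct). $G_3(n)$ is the maximal size of a multiplicative $3$-Sidon set contained in $\{1,2,\dots,n\}$. $\pi(x)$ is the number of primes not exceeding the real number $x$, and $\log$ is the natural logarithm. The symbol $o(1)$ denotes a function of $n$ tending to $0$ as $n\to\infty$; that is, the bound means: for every $\varepsilon>0$ there is $n_0$ such that for all integers $n\geq n_0$, $G_3(n)\leq \pi(n)+\pi(n/2)+n^{2/3}(\log n)^{2^{1/3}-1/3+\varepsilon}$. *)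

theory Defs
  imports Complex_Main "HOL-Computational_Algebra.Primes"
begin

definition mult_3_Sidon :: "nat set \<Rightarrow> bool" where
  "mult_3_Sidon A \<longleftrightarrow> A \<subseteq> {0<..} \<and>
     \<not> (\<exists>s1\<in>A. \<exists>s2\<in>A. \<exists>s3\<in>A. \<exists>t1\<in>A. \<exists>t2\<in>A. \<exists>t3\<in>A.
          distinct [s1, s2, s3, t1, t2, t3] \<and> s1 * s2 * s3 = t1 * t2 * t3)"

definition G3 :: "nat \<Rightarrow> nat" where
  "G3 n = Max {card A | A. A \<subseteq> {1..n} \<and> mult_3_Sidon A}"

(* The set under Max is finite and nonempty, so the maximum is a genuine one. *)

lemma finite_mult_3_Sidon_cards: "finite {card A | A. A \<subseteq> {1..n} \<and> mult_3_Sidon A}"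
  by (rule finite_subset[of _ "card ` Pow {1..n}"]) auto

lemma G3_attained: "\<exists>A. A \<subseteq> {1..n} \<and> mult_3_Sidon A \<and> card A = G3 n"
proof -
  have "card ({} :: nat set) \<in> {card A | A. A \<subseteq> {1..n} \<and> mult_3_Sidon A}"
    by (intro CollectI exI[of _ "{}"]) (simp add: mult_3_Sidon_def)
  then have "G3 n \<in> {card A | A. A \<subseteq> {1..n} \<and> mult_3_Sidon A}"
    unfolding G3_def by (intro Max_in finite_mult_3_Sidon_cards) blast
  then show ?thesis by auto
qed

lemma card_le_G3: "A \<subseteq> {1..n} \<Longrightarrow> mult_3_Sidon A \<Longrightarrow> card A \<le> G3 n"
  unfolding G3_def by (rule Max_ge[OF finite_mult_3_Sidon_cards]) auto

definition prime_pi :: "real \<Rightarrow> nat" where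
  "prime_pi x = card {p :: nat. prime p \<and> real p \<le> x}"

end

theory Submission
  imports Defs "HOL-Analysis.Harmonic_Numbers" "HOL-Real_Asymp.Real_Asymp"
begin

text \<open>Split each element of the set as \<open>a = x y\<close> with \<open>x\<close> its largest divisor up to \<open>n\<^bsup>2/3\<^esup>\<close>. In the
  bipartite graph with these edges \<open>(x, y)\<close>, a hexagon is a solution of the forbidden equation.
  Either \<open>y\<close> is a prime above \<open>n\<^bsup>2/3\<^esup>\<close>, which gives the main terms since such primes have degree at
  most two up to a total excess of \<open>n\<^bsup>2/3\<^esup>\<close>; or \<open>y \<le> x\<close>. In the second case the bound \<open>(m k)\<^bsup>2/3\<^esup>\<close>
  for hexagon-free graphs with parts of sizes \<open>m, k\<close> would give \<open>n\<^bsup>2/3\<^esup>\<close> for each of the \<open>log n\<close> dyadic ranges of \<open>x\<close>. By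
  maximality of \<open>x\<close>, however, all prime factors of \<open>y\<close> exceed \<open>n\<^bsup>2/3\<^esup> / x\<close>. So in most ranges \<open>y\<close> has
  no prime factor up to \<open>z = exp ((log n)\<^bsup>3/4\<^esup>)\<close>; such numbers have logarithmic density about
  \<open>1 / log z\<close>, and the total is \<open>O(n\<^bsup>2/3\<^esup> (log n)\<^bsup>3/4\<^esup>)\<close>, where \<open>3/4 < 2\<^bsup>1/3\<^esup> - 1/3\<close>.\<close>

section \<open>Hexagon-free bipartite graphs\<close>

text \<open>The two coordinates are the two sides of the graph, so the same number may occur on
  both. The six-cycle runs \<open>a1\<close>, \<open>b1\<close>, \<open>a2\<close>,
  \<open>b2\<close>, \<open>a3\<close>, \<open>b3\<close>.\<close>

definition hexagon_free :: "('a \<times> 'b) set \<Rightarrow> bool" where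
  "hexagon_free E \<longleftrightarrow> (\<forall>a1 a2 a3 b1 b2 b3. distinct [a1, a2, a3] \<longrightarrow> distinct [b1, b2, b3] \<longrightarrow>
     \<not> ((a1, b1) \<in> E \<and> (a2, b1) \<in> E \<and> (a2, b2) \<in> E \<and> (a3, b2) \<in> E \<and> (a3, b3) \<in> E \<and> (a1, b3) \<in> E))"

lemma hexagon_freeD:
  assumes "hexagon_free E" "(a1, b1) \<in> E" "(a2, b1) \<in> E" "(a2, b2) \<in> E" "(a3, b2) \<in> E"
    "(a3, b3) \<in> E" "(a1, b3) \<in> E" "a1 \<noteq> a2" "a1 \<noteq> a3" "a2 \<noteq> a3" "b1 \<noteq> b2" "b1 \<noteq> b3" "b2 \<noteq> b3"
  shows False
proof -
  have "distinct [a1, a2, a3]" "distinct [b1, b2, b3]"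
    using assms(8-13) by simp_all
  then show False
    using assms(1-7) unfolding hexagon_free_def by blast
qed

lemma hexagon_free_subset: "hexagon_free E \<Longrightarrow> F \<subseteq> E \<Longrightarrow> hexagon_free F"
  unfolding hexagon_free_def by blast

lemma hexagon_free_converse:
  assumes "hexagon_free E"
  shows "hexagon_free (E\<inverse>)"
  unfolding hexagon_free_def
proof (intro allI impI notI, elim conjE)
  fix a1 a2 a3 b1 b2 b3
  assume "distinct [a1, a2, a3]" "distinct [b1, b2, b3]"
    "(a1, b1) \<in> E\<inverse>" "(a2, b1) \<in> E\<inverse>" "(a2, b2) \<in> E\<inverse>" "(a3, b2) \<in> E\<inverse>" "(a3, b3) \<in> E\<inverse>" "(a1, b3) \<in> E\<inverse>"
  then show False
    using hexagon_freeD[OF assms, of b1 a2 b2 a3 b3 a1] by auto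
qed

section \<open>Degree excess over two in hexagon-free graphs\<close>

lemma obtain_notin_of_card_less:
  assumes "finite B" "card B < card A"
  obtains x where "x \<in> A" "x \<notin> B"
  using assms by (metis card_mono leD subsetI)

text \<open>As long as three points remain, some pair among them satisfies \<open>Q\<close>.
  Deleting one point of that pair loses the pair and lowers the size by one, so induction finds a
  new pair for each point beyond two.\<close>

lemma card_pairs_ge:
  assumes "finite S"
    and "\<And>x y z. {x, y, z} \<subseteq> S \<Longrightarrow> distinct [x, y, z] \<Longrightarrow> Q {x, y} \<or> Q {y, z} \<or> Q {x, z}"
  shows "card S - 2 \<le> card {P. P \<subseteq> S \<and> card P = 2 \<and> Q P}"
  using assms
proof (induction S rule: finite_psubset_induct)
  case (psubset S)
  show ?case
  proof (cases "card S \<ge> 3")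
    case True
    obtain x where x: "x \<in> S" by (rule obtain_notin_of_card_less[of "{}" S]) (use True in auto)
    obtain y where y: "y \<in> S" "y \<notin> {x}"
      by (rule obtain_notin_of_card_less[of "{x}" S]) (use True in auto)
    obtain z where z: "z \<in> S" "z \<notin> {x, y}"
      by (rule obtain_notin_of_card_less[of "{x, y}" S]) (use True in \<open>auto simp: card_insert_if\<close>)
    have "Q {x, y} \<or> Q {y, z} \<or> Q {x, z}"
      using psubset.prems[of x y z] x y z by auto
    then obtain a b where ab: "a \<in> S" "b \<in> S" "a \<noteq> b" "Q {a, b}"
      using x y z by blast
    let ?T = "S - {a}"
    have IH: "card ?T - 2 \<le> card {P. P \<subseteq> ?T \<and> card P = 2 \<and> Q P}"
      by (rule psubset.IH) (use ab psubset.prems in auto)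
    have fin: "finite {P. P \<subseteq> S \<and> card P = 2 \<and> Q P}"
      by (rule finite_subset[of _ "Pow S"]) (use psubset.hyps in auto)
    have "insert {a, b} {P. P \<subseteq> ?T \<and> card P = 2 \<and> Q P} \<subseteq> {P. P \<subseteq> S \<and> card P = 2 \<and> Q P}"
      using ab by auto
    from card_mono[OF fin this]
    have "card {P. P \<subseteq> S \<and> card P = 2 \<and> Q P} \<ge> Suc (card {P. P \<subseteq> ?T \<and> card P = 2 \<and> Q P})"
      by (subst (asm) card_insert_disjoint) (use psubset.hyps in auto)
    then show ?thesis
      using IH ab(1) psubset.hyps by simp
  qed simp
qed

text \<open>If all three pairs of a triple had at least three common neighbours, these could be chosen
  distinct and would close up to a hexagon. So the pairs with at most two common neighbours meet
  every triple, and each of them is counted at most twice.\<close>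

lemma hexagon_free_sum_degree_excess:
  assumes "hexagon_free E" "finite A" "finite B" "E \<subseteq> A \<times> B"
  shows "(\<Sum>b\<in>B. card {a. (a, b) \<in> E} - 2) \<le> (card A)\<^sup>2"
proof -
  define N where "N b = {a. (a, b) \<in> E}" for b
  define C where "C P = {b \<in> B. P \<subseteq> N b}" for P
  define L where "L = {P. P \<subseteq> A \<and> card P = 2 \<and> card (C P) \<le> 2}"
  have NA: "N b \<subseteq> A" for b using assms(4) by (auto simp: N_def)
  have finL: "finite L"
    by (rule finite_subset[of _ "Pow A"]) (use assms(2) in \<open>auto simp: L_def\<close>)
  have finC: "finite (C P)" for P using assms(3) by (simp add: C_def)
  have pairs: "card (N b) - 2 \<le> card {P \<in> L. P \<subseteq> N b}" for b
  proof -
    have "card (N b) - 2 \<le> card {P. P \<subseteq> N b \<and> card P = 2 \<and> card (C P) \<le> 2}"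
    proof (rule card_pairs_ge)
      show "finite (N b)" using NA assms(2) finite_subset by blast
    next
      fix x y z assume xyz: "{x, y, z} \<subseteq> N b" "distinct [x, y, z]"
      show "card (C {x, y}) \<le> 2 \<or> card (C {y, z}) \<le> 2 \<or> card (C {x, z}) \<le> 2"
      proof (rule ccontr)
        assume "\<not> ?thesis"
        then have gt: "card (C {x, y}) > 2" "card (C {y, z}) > 2" "card (C {x, z}) > 2" by auto
        obtain b1 where b1: "b1 \<in> C {x, y}"
          by (rule obtain_notin_of_card_less[of "{}" "C {x, y}"]) (use gt in auto)
        obtain b2 where b2: "b2 \<in> C {y, z}" "b2 \<notin> {b1}"
          by (rule obtain_notin_of_card_less[of "{b1}" "C {y, z}"]) (use gt in auto)
        obtain b3 where b3: "b3 \<in> C {x, z}" "b3 \<notin> {b1, b2}"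
          by (rule obtain_notin_of_card_less[of "{b1, b2}" "C {x, z}"])
            (use gt in \<open>auto simp: card_insert_if\<close>)
        show False
          by (rule hexagon_freeD[OF assms(1), of x b1 y b2 z b3])
            (use b1 b2 b3 xyz in \<open>auto simp: C_def N_def\<close>)
      qed
    qed
    also have "{P. P \<subseteq> N b \<and> card P = 2 \<and> card (C P) \<le> 2} = {P \<in> L. P \<subseteq> N b}"
      using NA[of b] by (auto simp: L_def)
    finally show ?thesis .
  qed
  have "(\<Sum>b\<in>B. card (N b) - 2) \<le> (\<Sum>b\<in>B. card {P \<in> L. P \<subseteq> N b})"
    by (intro sum_mono pairs)
  also have "\<dots> = (\<Sum>P\<in>L. card (C P))"
    unfolding C_def by (rule sum_multicount_gen) (use finL assms(3) in auto)
  also have "\<dots> \<le> (\<Sum>P\<in>L. 2)"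
    by (intro sum_mono) (auto simp: L_def)
  also have "\<dots> = 2 * card L" by simp
  also have "card L \<le> card {P. P \<subseteq> A \<and> card P = 2}"
    by (rule card_mono[OF finite_subset[of _ "Pow A"]]) (use assms(2) in \<open>auto simp: L_def\<close>)
  also have "\<dots> = card A choose 2"
    using assms(2) by (rule n_subsets)
  also have "2 * (card A choose 2) \<le> (card A)\<^sup>2"
    unfolding choose_two power2_eq_square
    by (metis (no_types) diff_le_self le_trans mult_le_mono2 times_div_less_eq_dividend)
  finally show ?thesis by (simp add: N_def)
qed

section \<open>The two-thirds power bound for hexagon-free graphs\<close>

text \<open>For two such partners \<open>y1\<close>, \<open>y2\<close>, three common neighbours with
  \<open>y\<close> leave room to choose \<open>a\<close> and \<open>b\<close> different from
  \<open>x\<close> and from each other, which closes the hexagon \<open>x\<close>,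
  \<open>y1\<close>, \<open>a\<close>, \<open>y\<close>, \<open>b\<close>,
  \<open>y2\<close>.\<close>

lemma heavy_partner_unique:
  assumes hex: "hexagon_free E" and fin: "finite E" and xy: "(x, y) \<in> E"
  shows "card {y'. (x, y') \<in> E \<and> y' \<noteq> y \<and> 3 \<le> card {a. (a, y) \<in> E \<and> (a, y') \<in> E}} \<le> 1"
proof -
  let ?H = "{y'. (x, y') \<in> E \<and> y' \<noteq> y \<and> 3 \<le> card {a. (a, y) \<in> E \<and> (a, y') \<in> E}}"
  have "y1 = y2" if y1: "y1 \<in> ?H" and y2: "y2 \<in> ?H" for y1 y2
  proof (rule ccontr)
    assume ne: "y1 \<noteq> y2"
    obtain a where a: "a \<in> {a. (a, y) \<in> E \<and> (a, y1) \<in> E}" "a \<notin> {x}"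
      by (rule obtain_notin_of_card_less[of "{x}" "{a. (a, y) \<in> E \<and> (a, y1) \<in> E}"]) (use y1 in auto)
    obtain b where b: "b \<in> {a. (a, y) \<in> E \<and> (a, y2) \<in> E}" "b \<notin> {x, a}"
      by (rule obtain_notin_of_card_less[of "{x, a}" "{a. (a, y) \<in> E \<and> (a, y2) \<in> E}"])
        (use y2 in \<open>auto simp: card_insert_if\<close>)
    show False
      by (rule hexagon_freeD[OF hex, of x y1 a y b y2]) (use a b y1 y2 ne in auto)
  qed
  moreover have "finite ?H"
    by (rule finite_subset[of _ "Range E"]) (use fin in \<open>auto simp: finite_Range\<close>)
  ultimately show ?thesis
    unfolding One_nat_def by (subst card_le_Suc0_iff_eq) blast+
qed

text \<open>Count the paths \<open>u \<midarrow> y \<midarrow> x \<midarrow> v\<close> whose middle edge joins two vertices of degree at least a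
  quarter of the average. Two of them with the same ends share an inner vertex, so at
  most four remain for given ends once the few paths with \<open>u = x\<close>, with \<open>y = v\<close>, or with three common
  neighbours of \<open>u, x\<close> or of \<open>y, v\<close> are discarded.\<close>

lemma hexagon_free_card_edges:
  fixes E :: "('a \<times> 'b) set"
  assumes hex: "hexagon_free E" and finA: "finite A" and finB: "finite B" and EAB: "E \<subseteq> A \<times> B"
  shows "card E \<le> 32 * card A \<or> card E \<le> 32 * card B \<or> (card E)^3 \<le> 256 * (card A * card B)\<^sup>2"
proof (rule ccontr)
  assume neg: "\<not> ?thesis"
  define e m k where "e = real (card E)" and "m = real (card A)" and "k = real (card B)"
  have e32: "e > 32 * m" "e > 32 * k" using neg by (simp_all add: e_def m_def k_def)
  have finE: "finite E" using EAB finA finB finite_subset by blast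
  have "E \<noteq> {}" using neg by auto
  then have pos: "m > 0" "k > 0" "e > 0"
    using EAB finA finB finE by (auto simp: m_def k_def e_def card_gt_0_iff)
  define N where "N y = {a. (a, y) \<in> E}" for y
  define M where "M x = {b. (x, b) \<in> E}" for x
  have finN: "finite (N y)" for y
    by (rule finite_subset[OF _ finA]) (use EAB in \<open>auto simp: N_def\<close>)
  have finM: "finite (M x)" for x
    by (rule finite_subset[OF _ finB]) (use EAB in \<open>auto simp: M_def\<close>)
  define F where "F = {(x, y) \<in> E. e / (4 * m) \<le> card (M x) \<and> e / (4 * k) \<le> card (N y)}"
  have FE: "F \<subseteq> E" by (auto simp: F_def)
  then have finF: "finite F" using finE finite_subset by blast
  define bad where "bad = (\<lambda>(x, y). {(u, v) \<in> N y \<times> M x. u = x \<or> v = y \<or>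
      3 \<le> card {a. (a, y) \<in> E \<and> (a, v) \<in> E} \<or> 3 \<le> card {b. (x, b) \<in> E \<and> (u, b) \<in> E}})"
  define good where "good = (\<lambda>(x, y). N y \<times> M x - bad (x, y))"

  \<comment> \<open>An edge outside \<open>F\<close> has an end of low degree. The low-degree
    vertices of one side carry at most \<open>e / 4\<close> edges, as there are at most
    \<open>m\<close> or \<open>k\<close> of them.\<close>
  have card_F: "real (card F) \<ge> e / 2"
  proof -
    define X where "X = {x \<in> A. real (card (M x)) < e / (4 * m)}"
    define Y where "Y = {y \<in> B. real (card (N y)) < e / (4 * k)}"
    have "E \<subseteq> F \<union> Sigma X M \<union> (\<lambda>(y, x). (x, y)) ` Sigma Y N"
      using EAB by (force simp: F_def X_def Y_def M_def N_def)
    then have "card E \<le> card (F \<union> Sigma X M \<union> (\<lambda>(y, x). (x, y)) ` Sigma Y N)"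
      by (rule card_mono[rotated]) (use finF finA finB finM finN in \<open>auto simp: X_def Y_def\<close>)
    also have "\<dots> \<le> card F + card (Sigma X M) + card (Sigma Y N)"
      by (intro order.trans[OF card_Un_le] add_mono order.refl card_image_le finite_SigmaI)
        (use finB finN in \<open>auto simp: Y_def\<close>)
    finally have "e \<le> card F + real (card (Sigma X M)) + real (card (Sigma Y N))"
      by (simp add: e_def)
    moreover have "real (card (Sigma X M)) \<le> e / 4"
    proof -
      have "real (card (Sigma X M)) = (\<Sum>x\<in>X. real (card (M x)))"
        by (subst card_SigmaI) (use finA finM in \<open>auto simp: X_def\<close>)
      also have "\<dots> \<le> real (card X) * (e / (4 * m))"
        by (rule sum_bounded_above) (auto simp: X_def)
      also have "\<dots> \<le> m * (e / (4 * m))"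
        unfolding m_def by (intro mult_right_mono)
          (use finA in \<open>auto simp: X_def e_def intro!: card_mono\<close>)
      finally show ?thesis using pos by simp
    qed
    moreover have "real (card (Sigma Y N)) \<le> e / 4"
    proof -
      have "real (card (Sigma Y N)) = (\<Sum>y\<in>Y. real (card (N y)))"
        by (subst card_SigmaI) (use finB finN in \<open>auto simp: Y_def\<close>)
      also have "\<dots> \<le> real (card Y) * (e / (4 * k))"
        by (rule sum_bounded_above) (auto simp: Y_def)
      also have "\<dots> \<le> k * (e / (4 * k))"
        unfolding k_def by (intro mult_right_mono)
          (use finB in \<open>auto simp: Y_def e_def intro!: card_mono\<close>)
      finally show ?thesis using pos by simp
    qed
    ultimately show ?thesis by simp
  qed

  have half_good: "real (card (good (x, y))) \<ge> (e / (4 * m)) * (e / (4 * k)) / 2" if xyF: "(x, y) \<in> F" for x y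
  proof -
    define a b where "a = real (card (M x))" and "b = real (card (N y))"
    have xyE: "(x, y) \<in> E" using xyF FE by blast
    have ab: "a \<ge> e / (4 * m)" "b \<ge> e / (4 * k)"
      using xyF by (auto simp: F_def a_def b_def)
    \<comment> \<open>Here the constant 32 is used: with both degrees at least 8, the at most
      \<open>2 * a + 2 * b\<close> bad paths make up no more than half of all
      \<open>a * b\<close>.\<close>
    have "e / (4 * m) \<ge> 8" "e / (4 * k) \<ge> 8"
      using e32 pos by (simp_all add: field_simps)
    then have ab8: "a \<ge> 8" "b \<ge> 8" using ab by linarith+
    let ?H = "{y'. (x, y') \<in> E \<and> y' \<noteq> y \<and> 3 \<le> card {a. (a, y) \<in> E \<and> (a, y') \<in> E}}"
    let ?H' = "{u. (u, y) \<in> E \<and> u \<noteq> x \<and> 3 \<le> card {b. (x, b) \<in> E \<and> (u, b) \<in> E}}"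
    have H: "card ?H \<le> 1" by (rule heavy_partner_unique[OF hex finE xyE])
    have H': "card ?H' \<le> 1"
      using heavy_partner_unique[OF hexagon_free_converse[OF hex], of y x] finE xyE by simp
    have finH: "finite ?H" by (rule finite_subset[OF _ finM[of x]]) (auto simp: M_def)
    have finH': "finite ?H'" by (rule finite_subset[OF _ finN[of y]]) (auto simp: N_def)
    \<comment> \<open>In a bad path \<open>v\<close> is \<open>y\<close> or its at most one heavy
      partner, or \<open>u\<close> is \<open>x\<close> or its at most one heavy partner.\<close>
    have "bad (x, y) \<subseteq> N y \<times> insert y ?H \<union> insert x ?H' \<times> M x"
      by (auto simp: bad_def M_def N_def)
    then have "card (bad (x, y)) \<le> card (N y \<times> insert y ?H \<union> insert x ?H' \<times> M x)"
      by (rule card_mono[rotated]) (use finM finN finH finH' in simp)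
    also have "\<dots> \<le> card (N y) * card (insert y ?H) + card (insert x ?H') * card (M x)"
      by (rule order.trans[OF card_Un_le]) (simp add: card_cartesian_product)
    also have "\<dots> \<le> card (N y) * 2 + 2 * card (M x)"
      by (intro add_mono mult_mono order.refl order.trans[OF card_insert_le_m1]) (use H H' in auto)
    finally have "real (card (bad (x, y))) \<le> 2 * a + 2 * b"
      unfolding a_def b_def by linarith
    moreover have "2 * a + 2 * b \<le> a * b / 2"
    proof -
      have "(a - 4) * (b - 4) \<ge> 4 * 4" by (rule mult_mono) (use ab8 in auto)
      then show ?thesis by (simp add: algebra_simps)
    qed
    moreover have "card (good (x, y)) = card (N y \<times> M x) - card (bad (x, y))"
      unfolding good_def prod.case
      by (rule card_Diff_subset) (auto simp: bad_def intro: finite_subset[OF _ finite_cartesian_product[OF finN finM]])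
    then have "card (N y \<times> M x) \<le> card (good (x, y)) + card (bad (x, y))"
      by linarith
    then have "real (card (N y) * card (M x)) \<le> real (card (good (x, y)) + card (bad (x, y)))"
      unfolding card_cartesian_product by (rule of_nat_mono)
    then have "real (card (good (x, y))) \<ge> a * b - card (bad (x, y))"
      by (simp add: a_def b_def mult.commute)
    moreover have "a * b \<ge> (e / (4 * m)) * (e / (4 * k))"
      by (intro mult_mono ab) (use pos in \<open>auto simp: a_def\<close>)
    ultimately have "(e / (4 * m)) * (e / (4 * k)) \<le> a * b" "a * b / 2 \<le> card (good (x, y))"
      by linarith+
    then show ?thesis by (meson divide_right_mono order_trans zero_le_numeral)
  qed

  have few: "card {p \<in> F. q \<in> good p} \<le> 4" for q
  proof (cases "{p \<in> F. q \<in> good p} = {}")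
    case False
    obtain u v where q: "q = (u, v)" by force
    from False obtain x0 y0 where 0: "(x0, y0) \<in> F" "(u, v) \<in> good (x0, y0)"
      unfolding q by auto
    let ?S = "{b. (x0, b) \<in> E \<and> (u, b) \<in> E}" and ?T = "{a. (a, y0) \<in> E \<and> (a, v) \<in> E}"
    \<comment> \<open>Middle edges of good paths with the same ends share a vertex, since disjoint
      ones would close the hexagon \<open>u\<close>, \<open>y\<close>, \<open>x\<close>,
      \<open>v\<close>, \<open>x0\<close>, \<open>y0\<close>. Goodness of the fixed path leaves at
      most two choices for the other vertex in either case.\<close>
    have "{p \<in> F. q \<in> good p} \<subseteq> {x0} \<times> ?S \<union> ?T \<times> {y0}"
    proof
      fix p assume "p \<in> {p \<in> F. q \<in> good p}"
      then obtain x y where p: "p = (x, y)" and xy: "(x, y) \<in> F" "(u, v) \<in> good (x, y)"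
        using q by (cases p) auto
      have "x = x0 \<or> y = y0"
        by (rule ccontr, rule hexagon_freeD[OF hex, of u y x v x0 y0])
          (use xy 0 FE in \<open>auto simp: good_def bad_def M_def N_def\<close>)
      then show "p \<in> {x0} \<times> ?S \<union> ?T \<times> {y0}"
        using xy 0 p FE by (auto simp: good_def bad_def M_def N_def)
    qed
    moreover have "finite ?S" by (rule finite_subset[OF _ finM[of x0]]) (auto simp: M_def)
    moreover have "finite ?T" by (rule finite_subset[OF _ finN[of y0]]) (auto simp: N_def)
    ultimately have "card {p \<in> F. q \<in> good p} \<le> card ({x0} \<times> ?S \<union> ?T \<times> {y0})"
      by (intro card_mono) auto
    also have "\<dots> \<le> card ?S + card ?T"
      by (rule order.trans[OF card_Un_le]) (simp add: card_cartesian_product)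
    also have "\<dots> \<le> 4"
      using 0(2) by (auto simp: good_def bad_def)
    finally show ?thesis .
  next
    case True
    then show ?thesis by (simp only: card.empty le0)
  qed

  have "(\<Sum>p\<in>F. card (good p)) = (\<Sum>p\<in>F. card {q \<in> A \<times> B. q \<in> good p})"
  proof (intro sum.cong refl arg_cong[where f = card])
    fix p assume "p \<in> F"
    show "good p = {q \<in> A \<times> B. q \<in> good p}"
      using EAB by (cases p) (auto simp: good_def M_def N_def)
  qed
  also have "\<dots> = (\<Sum>q\<in>A \<times> B. card {p \<in> F. q \<in> good p})"
    by (rule sum_multicount_gen) (use finF finA finB in auto)
  also have "\<dots> \<le> card (A \<times> B) * 4"
    using sum_bounded_above[of "A \<times> B" "\<lambda>q. card {p \<in> F. q \<in> good p}" 4] few by simp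
  finally have "real (\<Sum>p\<in>F. card (good p)) \<le> real (card (A \<times> B) * 4)"
    by (rule of_nat_mono)
  then have "(\<Sum>p\<in>F. real (card (good p))) \<le> 4 * m * k"
    by (simp add: card_cartesian_product m_def k_def)
  moreover have "(\<Sum>p\<in>F. real (card (good p))) \<ge> real (card F) * ((e / (4 * m)) * (e / (4 * k)) / 2)"
    by (rule sum_bounded_below) (use half_good in auto)
  moreover have "real (card F) * ((e / (4 * m)) * (e / (4 * k)) / 2) \<ge> e / 2 * ((e / (4 * m)) * (e / (4 * k)) / 2)"
    by (intro mult_right_mono card_F) (use pos in auto)
  \<comment> \<open>The left side is \<open>e ^ 3 / (64 * m * k)\<close>, which explains the factor
    256.\<close>
  ultimately have "e / 2 * ((e / (4 * m)) * (e / (4 * k)) / 2) \<le> 4 * m * k" by linarith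
  then have "e ^ 3 \<le> 256 * (m * k)\<^sup>2"
    using pos by (simp add: field_simps power3_eq_cube power2_eq_square)
  then have "real ((card E) ^ 3) \<le> real (256 * (card A * card B)\<^sup>2)"
    by (simp add: e_def m_def k_def)
  then show False using neg by (metis of_nat_le_iff)
qed

text \<open>The sum dominates whichever of the three alternatives holds, and sums can be added over
  many graphs. The factor 7 is the cube root of 256 rounded up.\<close>

corollary hexagon_free_card_edges_powr:
  assumes "hexagon_free E" "finite A" "finite B" "E \<subseteq> A \<times> B"
  shows "real (card E) \<le> 32 * real (card A) + 32 * real (card B) + 7 * (real (card A) * real (card B)) powr (2/3)"
proof -
  define w where "w = real (card A) * real (card B)"
  have "w \<ge> 0" by (simp add: w_def)
  have "real (card E) \<le> 32 * real (card A) \<or> real (card E) \<le> 32 * real (card B)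
      \<or> real (card E) \<le> 7 * w powr (2/3)"
    using hexagon_free_card_edges[OF assms]
  proof (elim disjE)
    assume "card E ^ 3 \<le> 256 * (card A * card B)\<^sup>2"
    then have "real (card E ^ 3) \<le> real (256 * (card A * card B)\<^sup>2)" by (rule of_nat_mono)
    then have "real (card E) ^ 3 \<le> 256 * w\<^sup>2" by (simp add: w_def)
    also have "\<dots> \<le> 343 * w\<^sup>2" by simp
    also have "w\<^sup>2 = (w powr (2/3)) ^ 3"
      using \<open>w \<ge> 0\<close> by (cases "w = 0") (simp_all add: powr_power)
    also have "343 * (w powr (2/3)) ^ 3 = (7 * w powr (2/3)) ^ 3" by (simp add: power_mult_distrib)
    finally have "real (card E) ^ 3 \<le> (7 * w powr (2/3)) ^ 3" .
    then have "real (card E) \<le> 7 * w powr (2/3)"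
      by (subst (asm) power_mono_iff) auto
    then show ?thesis by simp
  qed linarith+
  then show ?thesis
    unfolding w_def[symmetric] using powr_ge_zero[of w "2/3"] of_nat_0_le_iff[of "card A"]
      of_nat_0_le_iff[of "card B"] by linarith
qed

section \<open>Sidon sets as hexagon-free graphs\<close>

text \<open>Alternate edges of a hexagon form two matchings of the same six vertices, so their label
  products agree. Injectivity of the labelling makes the six labels distinct.\<close>

lemma mult_3_Sidon_hexagon_free:
  assumes sid: "mult_3_Sidon A" and sub: "\<And>x y. (x, y) \<in> E \<Longrightarrow> x * y \<in> A"
    and inj: "inj_on (\<lambda>(x, y). x * y) E"
  shows "hexagon_free E"
  unfolding hexagon_free_def
proof (intro allI impI notI, elim conjE)
  fix a1 a2 a3 b1 b2 b3
  assume d: "distinct [a1, a2, a3]" "distinct [b1, b2, b3]"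
    and E: "(a1, b1) \<in> E" "(a2, b1) \<in> E" "(a2, b2) \<in> E" "(a3, b2) \<in> E" "(a3, b3) \<in> E" "(a1, b3) \<in> E"
  let ?ps = "[(a1, b1), (a2, b2), (a3, b3), (a2, b1), (a3, b2), (a1, b3)]"
  have "inj_on (\<lambda>(x, y). x * y) (set ?ps)"
    by (rule inj_on_subset[OF inj]) (use E in auto)
  moreover have "distinct ?ps"
    using d by auto
  ultimately have "distinct (map (\<lambda>(x, y). x * y) ?ps)"
    unfolding distinct_map by blast
  then have "distinct [a1 * b1, a2 * b2, a3 * b3, a2 * b1, a3 * b2, a1 * b3]"
    unfolding list.map prod.case .
  moreover have "a1 * b1 * (a2 * b2) * (a3 * b3) = a2 * b1 * (a3 * b2) * (a1 * b3)"
    by (simp add: ac_simps)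
  ultimately show False
    using sid sub[OF E(1)] sub[OF E(2)] sub[OF E(3)] sub[OF E(4)] sub[OF E(5)] sub[OF E(6)]
    unfolding mult_3_Sidon_def by blast
qed

section \<open>Rough numbers\<close>

definition rough :: "nat \<Rightarrow> nat set" where
  "rough z = {v. \<forall>p. prime p \<longrightarrow> p dvd v \<longrightarrow> z < p}"

text \<open>The products of a number up to \<open>z\<close> and a \<open>z\<close>-rough number are pairwise different.\<close>

lemma harm_mult_sum_rough_le:
  "harm z * (\<Sum>v\<in>{1..n} \<inter> rough z. inverse (real v)) \<le> harm (z * n)"
proof -
  let ?R = "{1..n} \<inter> rough z" and ?f = "\<lambda>(k, v). k * v :: nat"
  have inj: "inj_on ?f ({1..z} \<times> ?R)"
  proof (rule inj_onI, clarify)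
    have cop: "coprime k v" if "k \<in> {1..z}" "v \<in> rough z" for k v
    proof (rule ccontr)
      assume "\<not> coprime k v"
      then obtain p where "prime p" "p dvd gcd k v"
        using prime_factor_nat[of "gcd k v"] by (auto simp: coprime_iff_gcd_eq_1)
      then have "p \<le> k" "z < p"
        using that by (auto simp: rough_def dvd_imp_le)
      then show False using that by simp
    qed
    fix k v k' v'
    assume a: "k \<in> {1..z}" "k' \<in> {1..z}" "v \<in> rough z" "v' \<in> rough z" "k * v = k' * v'"
    \<comment> \<open>\<open>k\<close> is coprime to \<open>v'\<close> and \<open>k'\<close> to
      \<open>v\<close>, so in \<open>k * v = k' * v'\<close> each of \<open>k\<close>,
      \<open>k'\<close> divides the other.\<close>
    have "k dvd k'" "k' dvd k"
      using cop[OF a(1,4)] cop[OF a(2,3)] a(5)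
      by (metis coprime_dvd_mult_left_iff dvd_triv_left)+
    then have "k = k'" by (rule dvd_antisym)
    then show "k = k' \<and> v = v'" using a by simp
  qed
  have "harm z * (\<Sum>v\<in>?R. inverse (real v)) = (\<Sum>(k, v)\<in>{1..z} \<times> ?R. inverse (real k) * inverse (real v))"
    by (simp add: harm_def sum_product sum.cartesian_product)
  also have "\<dots> = (\<Sum>p\<in>{1..z} \<times> ?R. inverse (real (?f p)))"
    by (intro sum.cong) auto
  also have "\<dots> = (\<Sum>m\<in>?f ` ({1..z} \<times> ?R). inverse (real m))"
    by (subst sum.reindex[OF inj]) simp
  also have "\<dots> \<le> (\<Sum>m=1..z * n. inverse (real m))"
    by (intro sum_mono2) (auto intro!: mult_le_mono)
  finally show ?thesis by (simp add: harm_def)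
qed

text \<open>Dividing the harmonic inequality by \<open>harm z\<close>, which is at least
  \<open>ln (z + 1)\<close>, shows that rough numbers have logarithmic density about
  \<open>1 / ln z\<close>.\<close>

lemma sum_rough_le:
  assumes "z \<ge> 1" "n \<ge> 1"
  shows "(\<Sum>v\<in>{1..n} \<inter> rough z. inverse (real v)) \<le> (1 + ln z + ln n) / ln (real z + 1)"
proof -
  define S where "S = (\<Sum>v\<in>{1..n} \<inter> rough z. inverse (real v))"
  have "S \<ge> 0" unfolding S_def by (intro sum_nonneg) auto
  then have "ln (real z + 1) * S \<le> harm z * S"
    by (intro mult_right_mono ln_le_harm)
  also have "\<dots> \<le> harm (z * n)"
    unfolding S_def by (rule harm_mult_sum_rough_le)
  \<comment> \<open>\<open>harm m - ln m\<close> decreases in \<open>m\<close> and equals 1 at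
    \<open>m = 1\<close>.\<close>
  also have "\<dots> \<le> ln (real (z * n)) + 1"
    using euler_mascheroni_sequence_decreasing[of 1 "z * n"] assms by (simp add: harm_expand)
  also have "\<dots> = 1 + ln z + ln n"
    using assms by (simp add: ln_mult)
  finally show ?thesis
    using assms by (simp add: S_def pos_le_divide_eq mult.commute)
qed

section \<open>Elementary estimates for dyadic sums\<close>

lemma sum_power2_le:
  assumes "finite J" "\<And>j. j \<in> J \<Longrightarrow> 2 ^ j \<le> y" "0 \<le> y"
  shows "(\<Sum>j\<in>J. 2 ^ j) \<le> 2 * (y :: real)"
proof (cases "J = {}")
  case False
  have "(\<Sum>j\<in>J. 2 ^ j :: real) \<le> (\<Sum>j<Suc (Max J). 2 ^ j)"
    using assms(1) by (intro sum_mono2) (auto simp: less_Suc_eq_le)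
  also have "\<dots> = 2 * 2 ^ Max J - 1"
    by (subst sum_gp_strict) auto
  also have "\<dots> \<le> 2 * y"
    using assms(2)[OF Max_in[OF assms(1) False]] by simp
  finally show ?thesis .
qed (use assms in auto)

text \<open>The hypothesis \<open>a \<le> b + 1\<close> covers empty \<open>J\<close>, where the
  bound must still be nonnegative.\<close>

lemma card_nat_interval_le:
  assumes "finite J" "\<And>j. j \<in> J \<Longrightarrow> a \<le> real j \<and> real j \<le> b" "a \<le> b + 1"
  shows "real (card J) \<le> b - a + 1"
proof (cases "J = {}")
  case False
  have "card J \<le> card {Min J..Max J}"
    using assms(1) by (intro card_mono) auto
  also have "\<dots> = Suc (Max J) - Min J" by simp
  also have "real \<dots> = real (Max J) + 1 - real (Min J)"
    using Min_le[OF assms(1) Max_in[OF assms(1) False]] by (subst of_nat_diff) auto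
  finally show ?thesis
    using assms(2)[OF Max_in[OF assms(1) False]] assms(2)[OF Min_in[OF assms(1) False]] by linarith
qed (use assms in auto)

text \<open>With \<open>t\<close> the cube root of \<open>x\<close>, either
  \<open>s * t \<ge> 1\<close> and the first term suffices, or \<open>t < 1 / s\<close> and the
  second does. This replaces a sum of two-thirds powers by a plain sum, with \<open>s\<close> free
  to be optimized.\<close>

lemma powr_two_thirds_le:
  fixes x s :: real
  assumes "x \<ge> 0" "s > 0"
  shows "x powr (2/3) \<le> s * x + 1 / s\<^sup>2"
proof -
  define t where "t = x powr (1/3)"
  have t: "t \<ge> 0" "x = t ^ 3" "x powr (2/3) = t\<^sup>2"
    using assms(1) by (cases "x = 0"; simp add: t_def powr_power)+
  show ?thesis
  proof (cases "s * t \<ge> 1")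
    case True
    then have "1 * t\<^sup>2 \<le> (s * t) * t\<^sup>2" by (intro mult_right_mono) auto
    also have "\<dots> = s * x" by (simp add: t power3_eq_cube power2_eq_square)
    finally show ?thesis using assms(2) by (simp add: t(3) add_increasing2)
  next
    case False
    then have "t\<^sup>2 \<le> (1 / s)\<^sup>2"
      using t(1) assms(2) by (intro power_mono) (auto simp: field_simps)
    then show ?thesis using assms by (simp add: t(3) power_one_over add_increasing)
  qed
qed

section \<open>Multiplicative 3-Sidon sets\<close>

text \<open>A prime above \<open>n powr (2/3)\<close> leaves \<open>x \<le> n powr (1/3)\<close>, so
  the total degree excess over two is at most \<open>n powr (2/3)\<close>. Degree above one requires
  \<open>2 * p \<le> n\<close>, and the first two edges per prime give the two prime counts.\<close>

lemma card_edges_large_prime: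
  fixes E :: "(nat \<times> nat) set"
  assumes hex: "hexagon_free E"
    and E: "\<And>x p. (x, p) \<in> E \<Longrightarrow> 1 \<le> x \<and> prime p \<and> x * p \<le> n \<and> n\<^sup>2 < p ^ 3"
  shows "real (card E) \<le> real (prime_pi (real n)) + real (prime_pi (real n / 2)) + real n powr (2/3)"
proof -
  define k where "k = nat \<lfloor>real n powr (1/3)\<rfloor>"
  define B where "B = {p. prime p \<and> p \<le> n}"
  define N where "N p = {x. (x, p) \<in> E}" for p
  have finB: "finite B" by (rule finite_subset[of _ "{..n}"]) (auto simp: B_def)
  have x_le: "x \<le> k" if xp: "(x, p) \<in> E" for x p
  proof -
    have "x ^ 3 * n\<^sup>2 \<le> x ^ 3 * p ^ 3" using E[OF xp] by (intro mult_le_mono2) auto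
    also have "\<dots> = (x * p) ^ 3" by (simp add: power_mult_distrib)
    also have "\<dots> \<le> n ^ 3" using E[OF xp] by (intro power_mono) auto
    also have "n ^ 3 = n * n\<^sup>2" by (simp add: power3_eq_cube power2_eq_square)
    finally have "x ^ 3 * n\<^sup>2 \<le> n * n\<^sup>2" .
    moreover have "n \<noteq> 0" using E[OF xp] prime_gt_0_nat[of p] by (cases n) auto
    ultimately have "x ^ 3 \<le> n" by simp
    then have "real x ^ 3 \<le> real n" by (metis of_nat_le_iff of_nat_power)
    also have "\<dots> = (real n powr (1/3)) ^ 3"
      using \<open>n \<noteq> 0\<close> by (simp add: powr_power)
    finally have "real x \<le> real n powr (1/3)"
      by (subst (asm) power_mono_iff) auto
    then show ?thesis by (simp add: k_def le_nat_floor)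
  qed
  have p_le: "p \<le> n" if "(x, p) \<in> E" for x p
    using E[OF that] by (metis le_trans mult_le_mono1 nat_mult_1)
  have sub: "E \<subseteq> {1..k} \<times> B"
    using x_le p_le E by (auto simp: B_def)
  have finN: "finite (N p)" for p
    by (rule finite_subset[of _ "{1..k}"]) (use sub in \<open>auto simp: N_def\<close>)
  have "E = (\<lambda>(p, x). (x, p)) ` Sigma B N"
    using sub by (force simp: N_def)
  then have "card E \<le> card (Sigma B N)"
    by (metis card_image_le finB finN finite_SigmaI)
  also have "\<dots> = (\<Sum>p\<in>B. card (N p))"
    by (rule card_SigmaI) (use finB finN in auto)
  also have "\<dots> \<le> (\<Sum>p\<in>B. (card (N p) - 2) + (1 + (if 2 * p \<le> n then 1 else 0)))"
  proof (intro sum_mono)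
    fix p assume "p \<in> B"
    show "card (N p) \<le> (card (N p) - 2) + (1 + (if 2 * p \<le> n then 1 else 0))"
    proof (cases "2 * p \<le> n")
      case False
      have "N p \<subseteq> {1}"
      proof
        fix x assume "x \<in> N p"
        then have "1 \<le> x" "x * p \<le> n" using E by (auto simp: N_def)
        then have "\<not> 2 \<le> x" using False mult_le_mono1[of 2 x p] by linarith
        then show "x \<in> {1}" using \<open>1 \<le> x\<close> by simp
      qed
      then have "card (N p) \<le> 1" using card_mono[of "{1::nat}" "N p"] by simp
      then show ?thesis by simp
    qed simp
  qed
  also have "\<dots> = (\<Sum>p\<in>B. card (N p) - 2) + card B + card {p \<in> B. 2 * p \<le> n}"
    unfolding sum.distrib using finB by (simp add: sum.If_cases Int_def)
  also have "(\<Sum>p\<in>B. card (N p) - 2) \<le> k\<^sup>2"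
    using hexagon_free_sum_degree_excess[OF hex _ finB sub] by (simp add: N_def)
  also have "card B = prime_pi (real n)"
    by (simp add: B_def prime_pi_def)
  also have "{p \<in> B. 2 * p \<le> n} = {p. prime p \<and> real p \<le> real n / 2}"
    by (auto simp: B_def)
  also have "card \<dots> = prime_pi (real n / 2)"
    by (simp add: prime_pi_def)
  finally have "real (card E) \<le> real (k\<^sup>2 + prime_pi (real n) + prime_pi (real n / 2))"
    by (rule of_nat_mono) simp_all
  moreover have "real (k\<^sup>2) \<le> (real n powr (1/3))\<^sup>2"
    unfolding of_nat_power by (rule power_mono) (auto simp: k_def)
  moreover have "(real n powr (1/3))\<^sup>2 = real n powr (2/3)"
    by (cases "n = 0") (auto simp: powr_power)
  ultimately show ?thesis by simp
qed

text \<open>Group the edges by the dyadic size \<open>2\<^sup>j\<close> of \<open>x\<close>. When \<open>2\<^sup>j\<close> is well below \<open>n\<^bsup>2/3\<^esup>\<close>, the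
  last hypothesis forces \<open>y\<close> to be \<open>z\<close>-rough. With \<open>d j\<close> the density of these \<open>y\<close> among the numbers
  up to \<open>n / 2\<^sup>j\<close>, the group has about \<open>n\<^bsup>2/3\<^esup> (d j)\<^bsup>2/3\<^esup>\<close> edges, and \<open>d j\<close> is small on average.\<close>

lemma card_edges_smooth:
  fixes E :: "(nat \<times> nat) set" and n z :: nat and s :: real
  assumes hex: "hexagon_free E" and n: "n \<ge> 1" and z: "z \<ge> 1" and s: "s > 0"
    and E: "\<And>x y. (x, y) \<in> E \<Longrightarrow> 1 \<le> x \<and> 1 \<le> y \<and> x * y \<le> n \<and> x ^ 3 \<le> n\<^sup>2 \<and> y \<le> x
              \<and> (\<forall>p. prime p \<longrightarrow> p dvd y \<longrightarrow> n\<^sup>2 < (x * p) ^ 3)"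
  defines "X \<equiv> real n powr (2/3)" and "L \<equiv> ln (real n)"
  shows "real (card E) \<le> 64 * X + 32 * (L + 1) * sqrt (real n)
           + 7 * X * (2 + 3 / 2 * ln (real z) + s * (2 * ((1 + ln (real z) + L) / ln (real z + 1))) + (L + 1) / s\<^sup>2)"
proof -
  have X: "X > 0" "X ^ 3 = real n ^ 2"
    using n by (simp_all add: X_def powr_power)
  have L: "L \<ge> 0" using n by (simp add: L_def)
  have lnz: "ln (real z) \<ge> 0" using z by simp
  define J where "J = {j::nat. (2 ^ j) ^ 3 \<le> n\<^sup>2}"
  have finJ: "finite J"
  proof (rule finite_subset[of _ "{..n\<^sup>2}"])
    have "j \<le> (2 ^ j) ^ 3" for j :: nat
      by (rule order.trans[OF less_imp_le[OF less_exp]]) (simp add: self_le_power)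
    then show "J \<subseteq> {..n\<^sup>2}" by (auto simp: J_def intro: order.trans)
  qed simp
  have J_le: "2 ^ j \<le> X" if "j \<in> J" for j
  proof -
    have "real ((2 ^ j) ^ 3) \<le> real (n\<^sup>2)" using that unfolding J_def by (intro of_nat_mono) auto
    then have "(2 ^ j) ^ 3 \<le> X ^ 3" by (simp add: X)
    then show ?thesis using X(1) by (subst (asm) power_mono_iff) auto
  qed
  have lnX: "ln X = 2 / 3 * L" by (simp add: X_def L_def ln_powr)
  have J_ln: "real j * ln 2 \<le> 2 / 3 * L" if "j \<in> J" for j
  proof -
    have "ln (2 ^ j) \<le> ln X" using J_le[OF that] X by (subst ln_le_cancel_iff) auto
    then show ?thesis by (simp add: lnX ln_realpow)
  qed
  have cardJ: "real (card J) \<le> L + 1"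
  proof -
    have "0 \<le> real j \<and> real j \<le> L" if "j \<in> J" for j
    proof -
      \<comment> \<open>The bound 2/3 for \<open>ln 2\<close> cancels the 2/3 in
        \<open>J_ln\<close>.\<close>
      have "real j * (2/3) \<le> real j * ln 2" by (intro mult_left_mono ln2_ge_two_thirds) auto
      then show ?thesis using J_ln[OF that] by simp
    qed
    from card_nat_interval_le[OF finJ this] show ?thesis using L by simp
  qed

  define D where "D j = {(x, y) \<in> E. 2 ^ j \<le> x \<and> x < 2 ^ (j + 1)}" for j
  define V where "V j = snd ` D j" for j
  define d where "d j = 2 ^ j * real (card (V j)) / real n" for j
  have V: "V j \<subseteq> {1..n div 2 ^ j}" for j
  proof
    fix y assume "y \<in> V j"
    then obtain x where x: "(x, y) \<in> E" "2 ^ j \<le> x" by (auto simp: V_def D_def)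
    have "2 ^ j * y \<le> n" using E[OF x(1)] x(2) by (meson le_trans mult_le_mono1)
    then show "y \<in> {1..n div 2 ^ j}"
      using E[OF x(1)] by (simp add: less_eq_div_iff_mult_less_eq mult.commute)
  qed
  have finV: "finite (V j)" for j using V finite_subset by blast
  have d0: "d j \<ge> 0" for j by (simp add: d_def)
  have d1: "d j \<le> 1" for j
  proof -
    have "2 ^ j * card (V j) \<le> 2 ^ j * (n div 2 ^ j)"
      using card_mono[OF _ V[of j]] by simp
    also have "\<dots> \<le> n" by simp
    finally have "real (2 ^ j * card (V j)) \<le> real n" by (rule of_nat_mono)
    then show ?thesis using n by (simp add: d_def)
  qed
  \<comment> \<open>From \<open>y \<le> x\<close> and \<open>x * y \<le> n\<close> follows
    \<open>y * y \<le> n\<close>; so the linear term in \<open>card (V j)\<close> costs only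
    \<open>sqrt n\<close> per range.\<close>
  have V_sqrt: "real (card (V j)) \<le> sqrt n" for j
  proof -
    have "V j \<subseteq> {1..nat \<lfloor>sqrt n\<rfloor>}"
    proof
      fix y assume "y \<in> V j"
      then obtain x where x: "(x, y) \<in> E" by (auto simp: V_def D_def)
      have "y * y \<le> n" using E[OF x] by (meson le_trans mult_le_mono1)
      then have "real y \<le> sqrt n" by (intro real_le_rsqrt) (simp add: power2_eq_square flip: of_nat_mult)
      then show "y \<in> {1..nat \<lfloor>sqrt n\<rfloor>}" using E[OF x] by (simp add: le_nat_floor)
    qed
    from card_mono[OF _ this] have "card (V j) \<le> nat \<lfloor>sqrt n\<rfloor>" by simp
    then show ?thesis by (simp add: le_nat_iff le_floor_iff)
  qed
  have cardD: "real (card (D j)) \<le> 32 * 2 ^ j + 32 * sqrt n + 7 * X * d j powr (2/3)" for j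
  proof -
    have "real (card (D j)) \<le> 32 * real (card {2 ^ j..<2 ^ (j + 1) :: nat}) + 32 * real (card (V j))
        + 7 * (real (card {2 ^ j..<2 ^ (j + 1) :: nat}) * real (card (V j))) powr (2/3)"
    proof (rule hexagon_free_card_edges_powr)
      show "hexagon_free (D j)" by (rule hexagon_free_subset[OF hex]) (auto simp: D_def)
      show "D j \<subseteq> {2 ^ j..<2 ^ (j + 1)} \<times> V j" by (force simp: V_def D_def)
    qed (use finV in auto)
    also have "real (card {2 ^ j..<2 ^ (j + 1) :: nat}) = 2 ^ j" by simp
    also have "2 ^ j * real (card (V j)) = real n * d j" using n by (simp add: d_def)
    also have "(real n * d j) powr (2/3) = X * d j powr (2/3)"
      by (simp add: powr_mult d0 X_def)
    finally show ?thesis using V_sqrt[of j] by simp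
  qed

  have cardE: "real (card E) \<le> (\<Sum>j\<in>J. real (card (D j)))"
  proof -
    have "E \<subseteq> (\<Union>j\<in>J. D j)"
    proof
      fix e assume e: "e \<in> E"
      obtain x y where xy: "e = (x, y)" by force
      with e E have x: "1 \<le> x" "x ^ 3 \<le> n\<^sup>2" by auto
      obtain j where j: "2 ^ j \<le> x" "x < 2 ^ (j + 1)"
        using ex_power_ivl1[of 2 x] x(1) by auto
      have "(2 ^ j) ^ 3 \<le> x ^ 3" using j(1) by (intro power_mono) auto
      then have "(2 ^ j) ^ 3 \<le> n\<^sup>2" using x(2) by (rule order.trans)
      then have "j \<in> J" unfolding J_def by (rule CollectI)
      then show "e \<in> (\<Union>j\<in>J. D j)" using e xy j by (auto simp: D_def)
    qed
    moreover have "finite (D j)" for j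
    proof (rule finite_subset)
      show "D j \<subseteq> {2 ^ j..<2 ^ (j + 1)} \<times> V j" by (force simp: V_def D_def)
    qed (use finV in auto)
    ultimately have "card E \<le> card (\<Union>j\<in>J. D j)"
      using finJ by (intro card_mono) auto
    also have "\<dots> \<le> (\<Sum>j\<in>J. card (D j))" by (rule card_UN_le[OF finJ])
    finally have "real (card E) \<le> real (\<Sum>j\<in>J. card (D j))" by (rule of_nat_mono)
    then show ?thesis by simp
  qed

  \<comment> \<open>In these ranges even \<open>x * z\<close> stays within
    \<open>n powr (2/3)\<close>, so a prime factor of \<open>y\<close> up to \<open>z\<close> would
    contradict the last hypothesis.\<close>
  define G where "G = {j \<in> J. (2 ^ (j + 1) * z) ^ 3 \<le> n\<^sup>2}"
  have GJ: "G \<subseteq> J" by (auto simp: G_def)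
  have finG: "finite G" using GJ finJ finite_subset by blast
  \<comment> \<open>For the other ranges \<open>2 ^ j\<close> is within a factor
    \<open>2 * z\<close> of \<open>X\<close>, which confines \<open>j\<close> to an interval of
    length \<open>ln z / ln 2 + 1\<close>.\<close>
  have card_bad: "real (card (J - G)) \<le> 2 + 3 / 2 * ln (real z)"
  proof -
    have "(2 / 3 * L - ln z) / ln 2 - 1 \<le> real j \<and> real j \<le> 2 / 3 * L / ln 2" if j: "j \<in> J - G" for j
    proof -
      have "n\<^sup>2 < (2 ^ (j + 1) * z) ^ 3" using j by (auto simp: G_def)
      then have "real (n\<^sup>2) < real ((2 ^ (j + 1) * z) ^ 3)" by (simp only: of_nat_less_iff)
      then have "X ^ 3 < (2 ^ (j + 1) * real z) ^ 3" by (simp add: X)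
      then have "X < 2 ^ (j + 1) * real z" by (rule power_less_imp_less_base) simp
      then have "ln X < ln (2 ^ (j + 1) * real z)"
        using X z by (subst ln_less_cancel_iff) auto
      also have "\<dots> = ln (2 ^ (j + 1)) + ln (real z)"
        using z by (intro ln_mult_pos) auto
      also have "ln (2 ^ (j + 1) :: real) = (real j + 1) * ln 2"
        by (subst ln_realpow) auto
      finally have "2 / 3 * L - ln z \<le> (real j + 1) * ln 2" by (simp add: lnX)
      then have "(2 / 3 * L - ln z) / ln 2 \<le> real j + 1" by (simp add: pos_divide_le_eq)
      moreover have "real j \<le> 2 / 3 * L / ln 2"
        using J_ln[of j] j by (subst pos_le_divide_eq) auto
      ultimately show ?thesis by simp
    qed
    moreover have "(2 / 3 * L - ln z) / ln 2 - 1 \<le> 2 / 3 * L / ln 2 + 1"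
      using divide_nonneg_pos[OF lnz, of "ln 2"] by (simp add: diff_divide_distrib)
    ultimately have "real (card (J - G)) \<le> 2 / 3 * L / ln 2 - ((2 / 3 * L - ln z) / ln 2 - 1) + 1"
      using finJ by (intro card_nat_interval_le) auto
    also have "\<dots> = 2 + ln z / ln 2" by (simp add: diff_divide_distrib)
    also have "ln z / ln 2 \<le> ln z / (2/3)"
      using lnz ln2_ge_two_thirds by (intro divide_left_mono) auto
    finally show ?thesis by simp
  qed

  let ?R = "{1..n} \<inter> rough z"
  have V_rough: "V j \<subseteq> {v \<in> ?R. 2 ^ j * v \<le> n}" if j: "j \<in> G" for j
  proof
    fix y assume y: "y \<in> V j"
    then obtain x where x: "(x, y) \<in> E" "2 ^ j \<le> x" "x < 2 ^ (j + 1)" by (auto simp: V_def D_def)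
    have "y \<in> rough z"
      unfolding rough_def
    proof (intro CollectI allI impI, rule ccontr)
      fix p assume p: "prime p" "p dvd y" "\<not> z < p"
      have "n\<^sup>2 < (x * p) ^ 3" using E[OF x(1)] p by blast
      also have "\<dots> \<le> (2 ^ (j + 1) * z) ^ 3"
        using x p by (intro power_mono mult_mono) auto
      also have "\<dots> \<le> n\<^sup>2" using j by (simp add: G_def)
      finally show False by simp
    qed
    moreover have "2 ^ j * y \<le> n" using E[OF x(1)] x(2) by (meson le_trans mult_le_mono1)
    moreover have "1 * y \<le> 2 ^ j * y" by (intro mult_le_mono1) simp
    then have "y \<le> n" using \<open>2 ^ j * y \<le> n\<close> by linarith
    ultimately show "y \<in> {v \<in> ?R. 2 ^ j * v \<le> n}" using E[OF x(1)] by auto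
  qed
  \<comment> \<open>After exchanging sums, a rough \<open>v\<close> receives
    \<open>2 ^ j / n\<close> for each \<open>j\<close> with \<open>2 ^ j * v \<le> n\<close>, a
    geometric sum of at most \<open>2 / v\<close>; the density of rough numbers then
    applies.\<close>
  have sum_d: "(\<Sum>j\<in>G. d j) \<le> 2 * ((1 + ln (real z) + L) / ln (real z + 1))"
  proof -
    have "(\<Sum>j\<in>G. d j) \<le> (\<Sum>j\<in>G. \<Sum>v\<in>?R. if 2 ^ j * v \<le> n then 2 ^ j / real n else 0)"
    proof (intro sum_mono)
      fix j assume "j \<in> G"
      then have "card (V j) \<le> card {v \<in> ?R. 2 ^ j * v \<le> n}"
        by (intro card_mono V_rough) auto
      then have "d j \<le> 2 ^ j * real (card {v \<in> ?R. 2 ^ j * v \<le> n}) / real n"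
        unfolding d_def by (intro divide_right_mono mult_left_mono of_nat_mono) auto
      also have "\<dots> = (\<Sum>v\<in>?R. if 2 ^ j * v \<le> n then 2 ^ j / real n else 0)"
        by (simp add: sum.If_cases Int_def conj_ac)
      finally show "d j \<le> \<dots>" .
    qed
    also have "\<dots> = (\<Sum>v\<in>?R. \<Sum>j\<in>G. if 2 ^ j * v \<le> n then 2 ^ j / real n else 0)"
      by (rule sum.swap)
    also have "\<dots> \<le> (\<Sum>v\<in>?R. 2 * inverse (real v))"
    proof (intro sum_mono)
      fix v assume v: "v \<in> ?R"
      have "(\<Sum>j\<in>G. if 2 ^ j * v \<le> n then 2 ^ j / real n else 0) = (\<Sum>j\<in>{j \<in> G. 2 ^ j * v \<le> n}. 2 ^ j / real n)"
        using finG by (simp add: sum.If_cases Int_def)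
      also have "\<dots> = (\<Sum>j\<in>{j \<in> G. 2 ^ j * v \<le> n}. 2 ^ j) / real n"
        by (simp add: sum_divide_distrib)
      also have "\<dots> \<le> 2 * (real n / real v) / real n"
      proof (intro divide_right_mono sum_power2_le)
        fix j assume "j \<in> {j \<in> G. 2 ^ j * v \<le> n}"
        then have "real (2 ^ j * v) \<le> real n" by (intro of_nat_mono) auto
        then show "2 ^ j \<le> real n / real v" using v by (simp add: pos_le_divide_eq)
      qed (use finG in auto)
      also have "\<dots> = 2 * inverse (real v)" using n by (simp add: field_simps)
      finally show "(\<Sum>j\<in>G. if 2 ^ j * v \<le> n then 2 ^ j / real n else 0) \<le> 2 * inverse (real v)" .
    qed
    also have "\<dots> = 2 * (\<Sum>v\<in>?R. inverse (real v))" by (simp add: sum_distrib_left)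
    also have "\<dots> \<le> 2 * ((1 + ln (real z) + L) / ln (real z + 1))"
      unfolding L_def by (intro mult_left_mono sum_rough_le z n) auto
    finally show ?thesis .
  qed

  have "(\<Sum>j\<in>J. d j powr (2/3)) = (\<Sum>j\<in>J - G. d j powr (2/3)) + (\<Sum>j\<in>G. d j powr (2/3))"
    by (rule sum.subset_diff[OF GJ finJ])
  \<comment> \<open>The few ranges outside \<open>G\<close> get the trivial bound 1; those in
    \<open>G\<close> are linearized so that \<open>sum_d\<close> applies.\<close>
  also have "\<dots> \<le> (\<Sum>j\<in>J - G. 1) + (\<Sum>j\<in>G. s * d j + 1 / s\<^sup>2)"
    by (intro add_mono sum_mono powr_two_thirds_le d0 s powr_le1) (use d0 d1 in auto)
  also have "\<dots> = card (J - G) + s * (\<Sum>j\<in>G. d j) + card G / s\<^sup>2"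
    by (simp add: sum.distrib sum_distrib_left)
  also have "\<dots> \<le> (2 + 3 / 2 * ln (real z)) + s * (2 * ((1 + ln (real z) + L) / ln (real z + 1))) + (L + 1) / s\<^sup>2"
  proof (intro add_mono card_bad mult_left_mono sum_d divide_right_mono)
    have "real (card G) \<le> real (card J)" by (intro of_nat_mono card_mono finJ GJ)
    then show "real (card G) \<le> L + 1" using cardJ by simp
  qed (use s in auto)
  finally have sum_powr: "(\<Sum>j\<in>J. d j powr (2/3)) \<le> \<dots>" .

  have "real (card E) \<le> (\<Sum>j\<in>J. 32 * 2 ^ j + 32 * sqrt n + 7 * X * d j powr (2/3))"
    using cardE cardD by (meson order_trans sum_mono)
  also have "\<dots> = 32 * (\<Sum>j\<in>J. 2 ^ j) + 32 * sqrt n * card J + 7 * X * (\<Sum>j\<in>J. d j powr (2/3))"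
    by (simp add: sum.distrib sum_distrib_left)
  also have "\<dots> \<le> 32 * (2 * X) + 32 * sqrt n * (L + 1)
      + 7 * X * ((2 + 3 / 2 * ln (real z)) + s * (2 * ((1 + ln (real z) + L) / ln (real z + 1))) + (L + 1) / s\<^sup>2)"
    by (intro add_mono mult_left_mono sum_power2_le sum_powr cardJ finJ J_le) (use X in auto)
  finally show ?thesis by (simp add: algebra_simps)
qed

section \<open>Factorization at the largest low divisor\<close>

text \<open>The condition on cubes encodes \<open>d \<le> n powr (2/3)\<close> within the natural
  numbers.\<close>

definition largest_low_divisor :: "nat \<Rightarrow> nat \<Rightarrow> nat" where
  "largest_low_divisor n a = Max {d. d dvd a \<and> d ^ 3 \<le> n\<^sup>2}"

lemma largest_low_divisor:
  assumes "1 \<le> a" "1 \<le> n"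
  shows "largest_low_divisor n a dvd a" "largest_low_divisor n a ^ 3 \<le> n\<^sup>2"
    and "\<And>d. d dvd a \<Longrightarrow> d ^ 3 \<le> n\<^sup>2 \<Longrightarrow> d \<le> largest_low_divisor n a"
proof -
  let ?S = "{d. d dvd a \<and> d ^ 3 \<le> n\<^sup>2}"
  have fin: "finite ?S"
    by (rule finite_subset[of _ "{..a}"]) (use assms in \<open>auto intro: dvd_imp_le\<close>)
  have "1 \<in> ?S" using assms by simp
  then have "largest_low_divisor n a \<in> ?S"
    unfolding largest_low_divisor_def by (intro Max_in fin) blast
  then show "largest_low_divisor n a dvd a" "largest_low_divisor n a ^ 3 \<le> n\<^sup>2" by auto
  show "d \<le> largest_low_divisor n a" if "d dvd a" "d ^ 3 \<le> n\<^sup>2" for d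
    unfolding largest_low_divisor_def by (rule Max_ge[OF fin]) (use that in auto)
qed

text \<open>All three follow from maximality of \<open>x\<close>, tested against the divisors
  \<open>x * p\<close>, \<open>y\<close> and \<open>p\<close>. In the third, a composite
  \<open>y\<close> has a prime factor \<open>p\<close> of size at most \<open>sqrt n\<close>, so
  \<open>p \<le> x\<close>; but \<open>x ^ 3 < n\<close>, so \<open>x * p\<close> would be a larger
  low divisor.\<close>

lemma complement_largest_low_divisor:
  fixes n a x y :: nat
  assumes a: "1 \<le> a" "a \<le> n" and x: "x = largest_low_divisor n a" and y: "a = x * y"
  shows "prime p \<Longrightarrow> p dvd y \<Longrightarrow> n\<^sup>2 < (x * p) ^ 3"
    and "y ^ 3 \<le> n\<^sup>2 \<Longrightarrow> y \<le> x"
    and "n\<^sup>2 < y ^ 3 \<Longrightarrow> prime y"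
proof -
  have n: "1 \<le> n" using a by simp
  note lld = largest_low_divisor[OF a(1) n, folded x]
  have pos: "x > 0" "y > 0" using y a by (auto intro: Nat.gr0I)
  show 1: "n\<^sup>2 < (x * p) ^ 3" if "prime p" "p dvd y" for p
  proof (rule ccontr)
    assume "\<not> ?thesis"
    moreover have "x * p dvd a" using that y by simp
    ultimately have "x * p \<le> x" by (intro lld(3)) auto
    then show False using pos prime_gt_1_nat[OF that(1)] by simp
  qed
  show "y \<le> x" if "y ^ 3 \<le> n\<^sup>2" using lld(3)[of y] that y by simp
  show "prime y" if big: "n\<^sup>2 < y ^ 3"
  proof (rule ccontr)
    assume np: "\<not> prime y"
    have "y \<noteq> 1" using big n by (auto simp: power2_eq_square)
    obtain p where p: "prime p" "p dvd y" "p * p \<le> y"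
    proof -
      obtain q where q: "prime q" "q dvd y" using prime_factor_nat[OF \<open>y \<noteq> 1\<close>] by blast
      then obtain r where r: "y = q * r" by blast
      with np q have "r \<noteq> 1" by auto
      then obtain q' where q': "prime q'" "q' dvd r" using prime_factor_nat by blast
      have "r > 0" using pos r by (auto intro: Nat.gr0I)
      then have "q' \<le> r" using q' by (intro dvd_imp_le)
      show ?thesis
      proof (cases "q \<le> q'")
        case True
        then have "q * q \<le> y" using r \<open>q' \<le> r\<close> by simp
        then show ?thesis using that q by blast
      next
        case False
        then have "q' * q' \<le> y" using r \<open>q' \<le> r\<close> by (simp add: mult_le_mono)
        moreover have "q' dvd y" using q' r by simp
        ultimately show ?thesis using that q' by blast
      qed
    qed
    have "y \<le> n" using y a(2) pos by (metis le_trans mult_le_mono1 nat_mult_1 Suc_leI One_nat_def)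
    have "p ^ 3 \<le> n\<^sup>2"
    proof -
      have "(p ^ 3)\<^sup>2 = (p * p) ^ 3" by (simp add: power_mult_distrib power2_eq_square)
      also have "\<dots> \<le> n ^ 3" using p(3) \<open>y \<le> n\<close> by (intro power_mono) auto
      also have "\<dots> \<le> n ^ 4" using n by (intro power_increasing) auto
      also have "\<dots> = (n\<^sup>2)\<^sup>2" by simp
      finally show ?thesis by (subst (asm) power_mono_iff) auto
    qed
    moreover have "p dvd a" using p y by simp
    ultimately have px: "p \<le> x" by (intro lld(3))
    have "x ^ 3 * n\<^sup>2 < x ^ 3 * y ^ 3" using big pos by simp
    also have "\<dots> = a ^ 3" by (simp add: y power_mult_distrib)
    also have "\<dots> \<le> n ^ 3" using a by (intro power_mono) auto
    also have "\<dots> = n * n\<^sup>2" by (simp add: power3_eq_cube power2_eq_square)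
    finally have "x ^ 3 < n" by simp
    have "n\<^sup>2 < (x * p) ^ 3" by (rule 1[OF p(1,2)])
    also have "\<dots> \<le> (x * x) ^ 3" using px by (intro power_mono) auto
    also have "\<dots> = (x ^ 3)\<^sup>2" by (simp add: power_mult_distrib power2_eq_square)
    also have "\<dots> \<le> n\<^sup>2" using \<open>x ^ 3 < n\<close> by (intro power_mono) auto
    finally show False by simp
  qed
qed

section \<open>Assembling the bound and choosing the parameters\<close>

lemma card_mult_3_Sidon_le:
  fixes n z :: nat and s :: real
  assumes A: "A \<subseteq> {1..n}" "mult_3_Sidon A" and n: "n \<ge> 1" and z: "z \<ge> 1" and s: "s > 0"
  defines "X \<equiv> real n powr (2/3)" and "L \<equiv> ln (real n)"
  shows "real (card A) \<le> real (prime_pi (real n)) + real (prime_pi (real n / 2)) + (65 * X + 32 * (L + 1) * sqrt (real n)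
           + 7 * X * (2 + 3 / 2 * ln (real z) + s * (2 * ((1 + ln (real z) + L) / ln (real z + 1))) + (L + 1) / s\<^sup>2))"
proof -
  define f where "f a = (largest_low_divisor n a, a div largest_low_divisor n a)" for a
  define E where "E = f ` A"
  define E1 where "E1 = {(x, y) \<in> E. n\<^sup>2 < y ^ 3}"
  define E2 where "E2 = {(x, y) \<in> E. \<not> n\<^sup>2 < y ^ 3}"
  have E: "x * y \<in> A \<and> x * y \<in> {1..n} \<and> x = largest_low_divisor n (x * y) \<and> (x, y) = f (x * y)"
    if xy: "(x, y) \<in> E" for x y
  proof -
    obtain a where a: "a \<in> A" "(x, y) = f a" using xy by (auto simp: E_def)
    then have "a = x * y"
      using largest_low_divisor(1)[of a n] A(1) n by (auto simp: f_def)
    then show ?thesis using a A(1) by (auto simp: f_def)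
  qed
  have inj: "inj_on (\<lambda>(x, y). x * y) E"
    by (rule inj_on_inverseI[of _ f]) (use E in auto)
  have hex: "hexagon_free E"
    by (rule mult_3_Sidon_hexagon_free[OF A(2) _ inj]) (use E in blast)
  have finA: "finite A" using A(1) finite_subset by blast
  have "inj_on f A"
  proof (rule inj_on_inverseI[of _ "\<lambda>(x, y). x * y"])
    fix a assume "a \<in> A"
    then show "(\<lambda>(x, y). x * y) (f a) = a"
      using largest_low_divisor(1)[of a n] A(1) n by (auto simp: f_def)
  qed
  then have "card A = card E" by (simp add: E_def card_image)
  also have "E = E1 \<union> E2" by (auto simp: E1_def E2_def)
  also have "card (E1 \<union> E2) \<le> card E1 + card E2" by (rule card_Un_le)
  finally have "real (card A) \<le> real (card E1 + card E2)" by (rule of_nat_mono)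
  moreover have "real (card E1) \<le> real (prime_pi (real n)) + real (prime_pi (real n / 2)) + X"
    unfolding X_def
  proof (rule card_edges_large_prime)
    show "hexagon_free E1" by (rule hexagon_free_subset[OF hex]) (auto simp: E1_def)
    fix x y assume "(x, y) \<in> E1"
    then have xy: "(x, y) \<in> E" "n\<^sup>2 < y ^ 3" by (auto simp: E1_def)
    then have le: "1 \<le> x * y" "x * y \<le> n" using E[OF xy(1)] by auto
    then have "x \<ge> 1" by (cases x) auto
    moreover have "prime y"
      by (rule complement_largest_low_divisor(3)[OF le _ refl xy(2)]) (use E[OF xy(1)] in blast)
    ultimately show "1 \<le> x \<and> prime y \<and> x * y \<le> n \<and> n\<^sup>2 < y ^ 3" using le xy by blast
  qed
  moreover have "real (card E2) \<le> 64 * X + 32 * (L + 1) * sqrt (real n)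
           + 7 * X * (2 + 3 / 2 * ln (real z) + s * (2 * ((1 + ln (real z) + L) / ln (real z + 1))) + (L + 1) / s\<^sup>2)"
    unfolding X_def L_def
  proof (rule card_edges_smooth[OF _ n z s])
    show "hexagon_free E2" by (rule hexagon_free_subset[OF hex]) (auto simp: E2_def)
    fix x y assume "(x, y) \<in> E2"
    then have xy: "(x, y) \<in> E" "y ^ 3 \<le> n\<^sup>2" by (auto simp: E2_def)
    then have le: "1 \<le> x * y" "x * y \<le> n" and x: "x = largest_low_divisor n (x * y)"
      using E[OF xy(1)] by auto
    have "1 \<le> x" "1 \<le> y" using le(1) by (cases x; cases y; simp)+
    moreover have "x ^ 3 \<le> n\<^sup>2" using largest_low_divisor(2)[OF le(1) n] x by simp
    moreover have "y \<le> x" by (rule complement_largest_low_divisor(2)[OF le x refl xy(2)])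
    moreover have "\<forall>p. prime p \<longrightarrow> p dvd y \<longrightarrow> n\<^sup>2 < (x * p) ^ 3"
      using complement_largest_low_divisor(1)[OF le x refl] by blast
    ultimately show "1 \<le> x \<and> 1 \<le> y \<and> x * y \<le> n \<and> x ^ 3 \<le> n\<^sup>2 \<and> y \<le> x
        \<and> (\<forall>p. prime p \<longrightarrow> p dvd y \<longrightarrow> n\<^sup>2 < (x * p) ^ 3)"
      using le by blast
  qed
  ultimately show ?thesis by simp
qed

lemma eventually_G3_le:
  "eventually (\<lambda>n. real (G3 n) \<le> real (prime_pi (real n)) + real (prime_pi (real n / 2))
     + real n powr (2/3) * ln (real n) powr (9/10)) at_top"
proof -
  let ?L = "\<lambda>n::nat. ln (real n)"
  \<comment> \<open>With \<open>ln z\<close> about \<open>L powr (3/4)\<close> and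
    \<open>s = L powr (1/4)\<close>, the three terms in the bracket have orders 3/4, 1/2 and 1/2 in
    \<open>L\<close>; the exponent 9/10 absorbs all constants.\<close>
  have "eventually (\<lambda>n::nat. 65 * real n powr (2/3) + 32 * (?L n + 1) * sqrt (real n)
      + 7 * real n powr (2/3) * (2 + 3 / 2 * ?L n powr (3/4)
          + ?L n powr (1/4) * (2 * ((1 + ?L n powr (3/4) + ?L n) / ?L n powr (3/4)))
          + (?L n + 1) / (?L n powr (1/4))\<^sup>2)
    \<le> real n powr (2/3) * ?L n powr (9/10)) at_top"
    by real_asymp
  then show ?thesis
    using eventually_ge_at_top[of "3::nat"]
  proof eventually_elim
    case (elim n)
    define X L z where "X = real n powr (2/3)" and "L = ln (real n)" and "z = nat \<lfloor>exp (L powr (3/4))\<rfloor>"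
    obtain A where A: "A \<subseteq> {1..n}" "mult_3_Sidon A" "card A = G3 n"
      using G3_attained by blast
    have L: "L > 0" using elim(2) by (simp add: L_def)
    have X: "X \<ge> 0" by (simp add: X_def)
    have "exp (L powr (3/4)) \<ge> 1" by simp
    \<comment> \<open>Rounding down suits the numerators, where \<open>ln z\<close> occurs; the
      denominator has \<open>ln (z + 1)\<close>, which rounding keeps large enough.\<close>
    then have z: "z \<ge> 1" "real z \<le> exp (L powr (3/4))" "exp (L powr (3/4)) \<le> real z + 1"
      unfolding z_def by linarith+
    have "ln (real z) \<le> ln (exp (L powr (3/4)))" "ln (exp (L powr (3/4))) \<le> ln (real z + 1)"
      using z by (simp_all del: ln_exp)
    then have lnz: "ln (real z) \<le> L powr (3/4)" "L powr (3/4) \<le> ln (real z + 1)"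
      by simp_all
    have "real (card A) \<le> real (prime_pi (real n)) + real (prime_pi (real n / 2)) + (65 * X + 32 * (L + 1) * sqrt (real n)
        + 7 * X * (2 + 3 / 2 * ln (real z) + L powr (1/4) * (2 * ((1 + ln (real z) + L) / ln (real z + 1)))
            + (L + 1) / (L powr (1/4))\<^sup>2))"
      unfolding X_def L_def
      by (rule card_mult_3_Sidon_le[OF A(1,2)]) (use elim(2) z L in \<open>auto simp: L_def\<close>)
    also have "\<dots> \<le> real (prime_pi (real n)) + real (prime_pi (real n / 2)) + (65 * X + 32 * (L + 1) * sqrt (real n)
        + 7 * X * (2 + 3 / 2 * L powr (3/4) + L powr (1/4) * (2 * ((1 + L powr (3/4) + L) / L powr (3/4)))
            + (L + 1) / (L powr (1/4))\<^sup>2))"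
      by (intro add_mono mult_left_mono frac_le lnz order.refl) (use X L in auto)
    finally show ?case using elim(1) A(3) unfolding X_def L_def by linarith
  qed
qed

theorem theorem1:
  shows "\<forall>\<epsilon>::real. \<epsilon> > 0 \<longrightarrow> (\<exists>n0::nat. \<forall>n::nat. n \<ge> n0 \<longrightarrow>
           real (G3 n) \<le> real (prime_pi (real n)) + real (prime_pi (real n / 2))
             + real n powr (2/3) * ln (real n) powr (2 powr (1/3) - 1/3 + \<epsilon>))"
proof (intro allI impI)
  fix \<epsilon> :: real
  assume \<epsilon>: "\<epsilon> > 0"
  \<comment> \<open>Since \<open>5/4 - 1/3 = 11/12\<close>, this puts the target exponent above
    9/10.\<close>
  have "(5/4 :: real) ^ 3 \<le> 2"
    by (simp add: power3_eq_cube)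
  also have "(2 :: real) = (2 powr (1/3)) ^ 3"
    by (simp add: powr_power)
  finally have "(5/4 :: real) \<le> 2 powr (1/3)"
    by (subst (asm) power_mono_iff) auto
  then have exponent: "9/10 \<le> 2 powr (1/3) - 1/3 + \<epsilon>"
    using \<epsilon> by linarith
  have "eventually (\<lambda>n::nat. 1 \<le> ln (real n)) at_top" by real_asymp
  with eventually_G3_le have "eventually (\<lambda>n. real (G3 n) \<le> real (prime_pi (real n)) + real (prime_pi (real n / 2))
      + real n powr (2/3) * ln (real n) powr (2 powr (1/3) - 1/3 + \<epsilon>)) at_top"
  proof eventually_elim
    case (elim n)
    have "real n powr (2/3) * ln (real n) powr (9/10)
        \<le> real n powr (2/3) * ln (real n) powr (2 powr (1/3) - 1/3 + \<epsilon>)"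
      by (intro mult_left_mono powr_mono exponent elim(2)) auto
    then show ?case using elim(1) by linarith
  qed
  then show "\<exists>n0. \<forall>n\<ge>n0. real (G3 n) \<le> real (prime_pi (real n)) + real (prime_pi (real n / 2))
      + real n powr (2/3) * ln (real n) powr (2 powr (1/3) - 1/3 + \<epsilon>)"
    by (simp only: eventually_at_top_linorder)
qed

end
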